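(* Let $F$ be a field of characteristic $0$ and let $L$ be a non-nilpotent Leibniz algebra of finite dimension $n+1\ge 3$ over $F$. Suppose that $L$ has an ideal $K$ of codimension $1$ which, as a subalgebra, is cyclic and nilpotent. Then there exist an element $s\in L$ and a basis $\{b_1,\dots,b_n\}$ of $K$ such that: (1) $L=K\oplus\langle s\rangle$ with $s\neq 0$, $[s,s]=0$ (so $\langle s\rangle=Fs$); (2) $[b_1,b_1]=b_2$, $[b_1,b_{j-1}]=b_j$ for $3\le j\le n$, $[b_1,b_n]=0$, and $[b_m,b_k]=0$ for all $m>1$, $1\le k\le n$; (3) $[b_1,s]=-b_1$ and $[b_j,s]=0$ for all $j\ge2$; (4) $[s,b_j]=j\,b_j$ for all $1\le j\le n$.
   Context: A (left) Leibniz algebra over a field $F$ is an $F$-vector space $L$ with a bilinear bracket $[-,-]$ satisfying $[[a,b],c]=[a,[b,c]]-[b,[a,c]]$ for all $a,b,c\in L$. Ideals are two-sided. $\langle s\rangle$ denotes the subalgebra generated by $s$. A Leibniz algebra is cyclic if it is generated as an algebra by one element. The lower central series is $\gamma_1(L)=L$, $\gamma_{k+1}(L)=[L,\gamma_k(L)]$ (the span of all brackets); $L$ is nilpotent if $\gamma_{c+1}(L)=\langle 0\rangle$ for some $c$. The symbol $\oplus$ denotes direct sum of vector spaces. *)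

theory Defs
  imports Complex_Main
begin

(* Left Leibniz algebras: the underlying vector space is the whole type 'v. *)
locale leibniz_algebra = vector_space scale
  for scale :: "'f::field \<Rightarrow> 'v::ab_group_add \<Rightarrow> 'v" +
  fixes bracket :: "'v \<Rightarrow> 'v \<Rightarrow> 'v"
  assumes bracket_linear_right: "Vector_Spaces.linear scale scale (\<lambda>y. bracket x y)"
    and bracket_linear_left: "Vector_Spaces.linear scale scale (\<lambda>x. bracket x y)"
    and left_leibniz:
      "bracket (bracket x y) z = bracket x (bracket y z) - bracket y (bracket x z)"
begin

definition subalgebra :: "'v set \<Rightarrow> bool" where
  "subalgebra A \<longleftrightarrow> subspace A \<and> (\<forall>x\<in>A. \<forall>y\<in>A. bracket x y \<in> A)"

definition ideal :: "'v set \<Rightarrow> bool" where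
  "ideal I \<longleftrightarrow> subspace I \<and> (\<forall>x. \<forall>y\<in>I. bracket x y \<in> I \<and> bracket y x \<in> I)"

definition generated :: "'v set \<Rightarrow> 'v set" where
  "generated S = subalgebra hull S"

(* The predicates below are meant for subalgebras A, regarded as algebras in their own right. *)

definition cyclic :: "'v set \<Rightarrow> bool" where
  "cyclic A \<longleftrightarrow> (\<exists>a\<in>A. generated {a} = A)"

(* Indexing starts at 0: lower_central A k is the term usually written gamma_(k+1)(A). *)
primrec lower_central :: "'v set \<Rightarrow> nat \<Rightarrow> 'v set" where
  "lower_central A 0 = A"
| "lower_central A (Suc k) = span {bracket x y | x y. x \<in> A \<and> y \<in> lower_central A k}"

definition nilpotent :: "'v set \<Rightarrow> bool" where
  "nilpotent A \<longleftrightarrow> (\<exists>c. lower_central A c = {0})"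

definition finite_dimensional :: bool where
  "finite_dimensional \<longleftrightarrow> (\<exists>B. finite B \<and> span B = UNIV)"

definition direct_sum :: "'v set \<Rightarrow> 'v set \<Rightarrow> 'v set \<Rightarrow> bool" where
  "direct_sum W U V \<longleftrightarrow> subspace U \<and> subspace V \<and> W = {u + v | u v. u \<in> U \<and> v \<in> V} \<and> U \<inter> V = {0}"

definition basis_family :: "'v set \<Rightarrow> nat set \<Rightarrow> (nat \<Rightarrow> 'v) \<Rightarrow> bool" where
  "basis_family W I b \<longleftrightarrow> inj_on b I \<and> independent (b ` I) \<and> span (b ` I) = W"

end

end

theory Submission
  imports Defs
begin

text \<open>
  The ideal \<open>K\<close> is spanned by the iterated products \<open>a\<close>, \<open>[a, a]\<close>, \<open>[a, [a, a]]\<close>, \dots of its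
  generator \<open>a\<close>. Every power from the square on annihilates the whole algebra from the left, so
  all products of elements of \<open>K\<close> are known once left multiplication by \<open>a\<close> is, and that map
  shifts the powers by one until it reaches zero.

  Pick \<open>t\<close> outside \<open>K\<close>. Left multiplication by \<open>t\<close> is a derivation, so if \<open>[t, a]\<close> equals
  \<open>\<alpha> a\<close> modulo higher powers, it acts on the powers of \<open>a\<close> by a triangular matrix with diagonal
  \<open>\<alpha>, 2\<alpha>, 3\<alpha>, \<dots>\<close> (lemma \<open>left_mult_triangular\<close>). If \<open>\<alpha> = 0\<close>, then every left multiplication
  raises the filtration by powers and the algebra is nilpotent
  (\<open>nilpotent_if_eigenvalue_zero\<close>). Hence \<open>\<alpha> \<noteq> 0\<close>, and rescaling \<open>t\<close> makes \<open>\<alpha> = 1\<close>. In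
  characteristic zero the eigenvalues \<open>1, \<dots>, n\<close> are distinct and nonzero, and everything else is
  solving equations with the triangular map.

  The eigenvalue \<open>1\<close> has an eigenvector \<open>b\<^sub>1 = a - x\<close> with \<open>x\<close> in the span of the higher
  powers (\<open>left_mult_shifted_onto_tail\<close>). It generates \<open>K\<close> as well, and by the Leibniz rule its
  powers are exact eigenvectors for \<open>1, \<dots>, n\<close>; they are the basis.
  Next, \<open>[t, t]\<close> lies in the span of the higher powers, where left multiplication by \<open>t\<close> is
  invertible, so \<open>[t, t] = [t, w]\<close> for some such \<open>w\<close>. Then \<open>s = t - w\<close> has the same left
  multiplication as \<open>t\<close>, and \<open>[s, s] = 0\<close>.
  Finally \<open>y = [b\<^sub>1, s] + b\<^sub>1 = [b\<^sub>1, s] + [s, b\<^sub>1]\<close> annihilates from the left, which forces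
  it into the span of the higher powers, while \<open>[s, y] = y\<close>; but \<open>1\<close> is not an eigenvalue there
  (\<open>left_mult_eigenvector_zero\<close>), so \<open>y = 0\<close>.
\<close>

context leibniz_algebra
begin

section \<open>Left powers and their filtration\<close>

lemma bracket_add_right: "bracket x (y + z) = bracket x y + bracket x z"
  and bracket_diff_right: "bracket x (y - z) = bracket x y - bracket x z"
  and bracket_scale_right: "bracket x (scale c y) = scale c (bracket x y)"
  and bracket_zero_right: "bracket x 0 = 0"
  using bracket_linear_right[of x] unfolding linear_iff_module_hom
  by (simp_all add: module_hom.add module_hom.diff module_hom.scale module_hom.zero)

lemma bracket_add_left: "bracket (x + y) z = bracket x z + bracket y z"
  and bracket_diff_left: "bracket (x - y) z = bracket x z - bracket y z"
  and bracket_scale_left: "bracket (scale c x) z = scale c (bracket x z)"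
  and bracket_zero_left: "bracket 0 z = 0"
  using bracket_linear_left[of z] unfolding linear_iff_module_hom
  by (simp_all add: module_hom.add[where f="\<lambda>x. bracket x z"] module_hom.diff[where f="\<lambda>x. bracket x z"]
    module_hom.scale[where f="\<lambda>x. bracket x z"] module_hom.zero[where f="\<lambda>x. bracket x z"])

lemmas bracket_simps =
  bracket_add_right bracket_diff_right bracket_scale_right bracket_zero_right
  bracket_add_left bracket_diff_left bracket_scale_left bracket_zero_left

lemma left_mult_derivation:
  "bracket x (bracket y z) = bracket (bracket x y) z + bracket y (bracket x z)"
  by (simp add: left_leibniz)

lemma square_left_annihilates: "bracket (bracket x x) y = 0"
  by (simp add: left_leibniz)

lemma symmetrized_left_annihilates: "bracket (bracket x y + bracket y x) z = 0"
  by (simp add: bracket_add_left left_leibniz)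

text \<open>The exponent is shifted: \<open>left_power a k\<close> has \<open>k + 1\<close> factors, so there is no empty product.\<close>

definition left_power :: "'v \<Rightarrow> nat \<Rightarrow> 'v" where
  "left_power a k = (bracket a ^^ k) a"

lemma left_power_0: "left_power a 0 = a"
  by (simp add: left_power_def)

lemma left_power_Suc: "left_power a (Suc k) = bracket a (left_power a k)"
  by (simp add: left_power_def)

text \<open>These spans form the filtration of the subalgebra generated by \<open>a\<close> along which all maps
  below are triangular.\<close>

definition tail :: "'v \<Rightarrow> nat \<Rightarrow> 'v set" where
  "tail a k = span (left_power a ` {k..})"

lemma subspace_tail: "subspace (tail a k)"
  by (simp add: tail_def)

lemmas tail_closed = subspace_add[OF subspace_tail] subspace_diff[OF subspace_tail]
  subspace_scale[OF subspace_tail] subspace_0[OF subspace_tail]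

lemma left_power_in_tail: "k \<le> i \<Longrightarrow> left_power a i \<in> tail a k"
  by (auto simp: tail_def intro: span_base)

lemma tail_antimono: "k \<le> l \<Longrightarrow> tail a l \<subseteq> tail a k"
  unfolding tail_def by (rule span_mono) auto

lemma tail_split:
  assumes "x \<in> tail a k"
  obtains c y where "x = scale c (left_power a k) + y" "y \<in> tail a (Suc k)"
proof -
  have "{k..} = insert k {Suc k..}" by auto
  then have "x \<in> span (insert (left_power a k) (left_power a ` {Suc k..}))"
    using assms by (simp add: tail_def)
  then obtain c where "x - scale c (left_power a k) \<in> tail a (Suc k)"
    by (auto simp: span_breakdown_eq tail_def)
  then show thesis
    using that[of c "x - scale c (left_power a k)"] by simp
qed

lemma tail_induct [consumes 1, case_names power closed]:
  assumes "x \<in> tail a k" and "\<And>i. k \<le> i \<Longrightarrow> P (left_power a i)" and "subspace (Collect P)"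
  shows "P x"
  using assms(1) unfolding tail_def
  by (rule span_induct[OF _ assms(3)]) (use assms(2) in auto)

lemma bracket_generator_tail:
  assumes "x \<in> tail a k"
  shows "bracket a x \<in> tail a (Suc k)"
  using assms
proof (induction rule: tail_induct)
  case (power i)
  then show ?case
    using left_power_in_tail[of "Suc k" "Suc i" a] by (simp add: left_power_Suc)
next
  case closed
  then show ?case
    by (auto simp: subspace_def bracket_simps tail_closed)
qed

text \<open>A square annihilates from the left by the Leibniz identity. If \<open>y\<close> does, so does
  \<open>bracket a y\<close>, because its left multiplication is the commutator of those of \<open>a\<close> and \<open>y\<close>.\<close>

lemma tail_one_left_annihilates:
  assumes "x \<in> tail a (Suc 0)"
  shows "bracket x y = 0"
proof -
  have powers: "bracket (left_power a (Suc i)) z = 0" for i z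
  proof (induction i arbitrary: z)
    case 0
    show ?case
      by (simp add: left_power_Suc left_power_0 square_left_annihilates)
  next
    case (Suc i)
    have "bracket (left_power a (Suc (Suc i))) z =
      bracket a (bracket (left_power a (Suc i)) z) - bracket (left_power a (Suc i)) (bracket a z)"
      by (simp only: left_power_Suc[of a "Suc i"] left_leibniz)
    then show ?case
      by (simp add: Suc bracket_simps)
  qed
  show ?thesis
    using assms
  proof (induction rule: tail_induct)
    case (power i)
    then show ?case
      using powers by (cases i) auto
  next
    case closed
    then show ?case
      by (auto simp: subspace_def bracket_simps)
  qed
qed

lemma bracket_left_mod_tail:
  assumes "x = scale c a + y" "y \<in> tail a (Suc 0)"
  shows "bracket x z = scale c (bracket a z)"
  using assms by (simp add: bracket_simps tail_one_left_annihilates)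

lemma tail_eq_zero:
  assumes "left_power a n = 0"
  shows "tail a n = {0}"
proof -
  have "left_power a i = 0" if "n \<le> i" for i
    using that by (induction rule: dec_induct) (simp_all add: assms left_power_Suc bracket_simps)
  then have "left_power a ` {n..} = {0}"
    by (auto simp: image_iff)
  then show ?thesis
    by (simp add: tail_def)
qed

lemma generated_eq_tail: "generated {a} = tail a 0"
proof -
  have "subalgebra (tail a 0)"
    unfolding subalgebra_def
  proof (intro conjI ballI subspace_tail)
    fix x y assume x: "x \<in> tail a 0" and y: "y \<in> tail a 0"
    from x obtain c z where "x = scale c a + z" "z \<in> tail a (Suc 0)"
      by (rule tail_split) (simp add: left_power_0)
    then have "bracket x y = scale c (bracket a y)"
      by (rule bracket_left_mod_tail)
    then show "bracket x y \<in> tail a 0"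
      using bracket_generator_tail[OF y] tail_antimono[of 0 "Suc 0" a]
      by (auto simp: tail_closed)
  qed
  moreover have "a \<in> tail a 0"
    using left_power_in_tail[of 0 0 a] by (simp add: left_power_0)
  moreover have "tail a 0 \<subseteq> A" if A: "a \<in> A" "subalgebra A" for A
  proof -
    have "left_power a i \<in> A" for i
      by (induction i) (use A in \<open>auto simp: left_power_0 left_power_Suc subalgebra_def\<close>)
    then show ?thesis
      using A unfolding tail_def subalgebra_def by (intro span_minimal) auto
  qed
  ultimately show ?thesis
    unfolding generated_def by (intro hull_unique) auto
qed

text \<open>A relation expressing one power by higher ones can be multiplied by \<open>a\<close> until it kills the
  last nonzero power.\<close>

lemma left_power_notin_tail:
  assumes top: "left_power a n = 0" "left_power a (n - 1) \<noteq> 0" and "k < n"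
  shows "left_power a k \<notin> tail a (Suc k)"
proof
  assume k: "left_power a k \<in> tail a (Suc k)"
  have "k \<le> n - 1"
    using \<open>k < n\<close> by simp
  then have "left_power a (n - 1) \<in> tail a (Suc (n - 1))"
    by (induction rule: dec_induct) (simp_all add: k left_power_Suc bracket_generator_tail)
  then show False
    using top tail_eq_zero[of a n] \<open>k < n\<close> by simp
qed

lemma left_powers_independent:
  assumes top: "left_power a n = 0" "left_power a (n - 1) \<noteq> 0"
  shows "inj_on (left_power a) {..<n}" "independent (left_power a ` {..<n})"
proof -
  have "inj_on (left_power a) {k..<n} \<and> independent (left_power a ` {k..<n})" if "k \<le> n" for k
    using that
  proof (induction rule: inc_induct)
    case base
    show ?case by (simp add: independent_empty)
  next
    case (step k)
    have eq: "{k..<n} = insert k {Suc k..<n}"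
      using step.hyps by auto
    have "span (left_power a ` {Suc k..<n}) \<subseteq> tail a (Suc k)"
      unfolding tail_def by (rule span_mono) auto
    with left_power_notin_tail[OF top \<open>k < n\<close>]
    have notin: "left_power a k \<notin> span (left_power a ` {Suc k..<n})"
      by blast
    then have "left_power a k \<notin> left_power a ` {Suc k..<n}"
      by (auto intro: span_base)
    with notin step.IH show ?case
      unfolding eq by (simp add: independent_insertI)
  qed
  from this[of 0] show "inj_on (left_power a) {..<n}" "independent (left_power a ` {..<n})"
    by (simp_all add: atLeast0LessThan)
qed

lemma span_left_powers:
  assumes "left_power a n = 0"
  shows "span (left_power a ` {..<n}) = tail a 0"
proof
  show "span (left_power a ` {..<n}) \<subseteq> tail a 0"
    unfolding tail_def by (rule span_mono) auto
  have "left_power a i \<in> span (left_power a ` {..<n})" for i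
  proof (cases "i < n")
    case False
    then have "left_power a i \<in> tail a n"
      by (simp add: left_power_in_tail)
    then show ?thesis
      by (simp add: tail_eq_zero[OF assms] span_zero)
  qed (auto intro: span_base)
  then show "tail a 0 \<subseteq> span (left_power a ` {..<n})"
    unfolding tail_def by (intro span_minimal) auto
qed

lemma generated_square_zero:
  assumes "bracket s s = 0"
  shows "generated {s} = range (\<lambda>c. scale c s)"
proof -
  have "left_power s (Suc 0) = 0"
    using assms by (simp add: left_power_0 left_power_Suc)
  from span_left_powers[OF this] show ?thesis
    by (simp add: generated_eq_tail left_power_0 lessThan_Suc span_singleton)
qed

lemma left_power_in_lower_central:
  assumes "a \<in> A"
  shows "left_power a k \<in> lower_central A k"
  by (induction k) (use assms in \<open>auto simp: left_power_0 left_power_Suc intro!: span_base\<close>)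

text \<open>The powers of a generator must vanish eventually, since the \<open>k\<close>-th one lies in the \<open>k\<close>-th
  lower central term; the nonzero ones form a basis, so the dimension tells when they vanish.\<close>

lemma cyclic_nilpotent_generator:
  assumes "cyclic K" "nilpotent K" "dim K \<noteq> 0"
  obtains a where "K = tail a 0" "left_power a (dim K) = 0" "left_power a (dim K - 1) \<noteq> 0"
proof -
  obtain a where a: "a \<in> K" "K = tail a 0"
    using assms(1) by (auto simp: cyclic_def generated_eq_tail)
  obtain c where "lower_central K c = {0}"
    using assms(2) by (auto simp: nilpotent_def)
  with left_power_in_lower_central[OF a(1), of c] have ex: "left_power a c = 0"
    by simp
  define m where "m = (LEAST m. left_power a m = 0)"
  have m: "left_power a m = 0"
    unfolding m_def using ex by (rule LeastI)
  have "dim {0} = 0"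
    using dim_eq_card_independent[OF independent_empty] dim_span[of "{}"] by simp
  then have "m \<noteq> 0"
    using assms(3) m a(2) tail_eq_zero[of a 0] by (intro notI) simp
  then have top: "left_power a (m - 1) \<noteq> 0"
    using not_less_Least[of "m - 1" "\<lambda>m. left_power a m = 0"] by (simp add: m_def)
  note ind = left_powers_independent[OF m top]
  have "dim K = m"
    using dim_eq_card_independent[OF ind(2)] dim_span[of "left_power a ` {..<m}"]
      card_image[OF ind(1)] span_left_powers[OF m] a(2)
    by simp
  with a m top show thesis
    by (intro that[of a]) auto
qed

section \<open>Left multiplication as a triangular map\<close>

text \<open>Left multiplication by \<open>t\<close> is a derivation with eigenvalue \<open>\<alpha>\<close> on \<open>a\<close> modulo the first
  tail. The \<open>k\<close>-th left power is a product of \<open>k + 1\<close> factors \<open>a\<close>, so the Leibniz rule adds up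
  \<open>k + 1\<close> copies of \<open>\<alpha>\<close>. The error term of \<open>bracket t a\<close> does no harm when it lands in a left
  factor, because it annihilates from the left.\<close>

lemma left_mult_triangular:
  assumes t: "bracket t a - scale \<alpha> a \<in> tail a (Suc 0)"
  shows "bracket t (left_power a k) - scale (of_nat (Suc k) * \<alpha>) (left_power a k) \<in> tail a (Suc k)"
proof (induction k)
  case 0
  then show ?case
    using t by (simp add: left_power_0)
next
  case (Suc k)
  define y where "y = left_power a k"
  have "bracket (bracket t a) y = scale \<alpha> (bracket a y)"
    by (rule bracket_left_mod_tail[OF _ t]) simp
  then have "bracket t (bracket a y) = scale \<alpha> (bracket a y) + bracket a (bracket t y)"
    by (simp add: left_mult_derivation[of t a])
  moreover have "scale (of_nat (Suc (Suc k)) * \<alpha>) (bracket a y)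
      = scale \<alpha> (bracket a y) + scale (of_nat (Suc k) * \<alpha>) (bracket a y)"
    by (simp only: of_nat_Suc distrib_right mult_1 scale_left_distrib)
  ultimately have "bracket t (bracket a y) - scale (of_nat (Suc (Suc k)) * \<alpha>) (bracket a y)
      = bracket a (bracket t y - scale (of_nat (Suc k) * \<alpha>) y)"
    by (simp only: bracket_simps add_diff_add) simp
  then show ?case
    using bracket_generator_tail[OF Suc] by (simp only: left_power_Suc y_def)
qed

lemma left_mult_preserves_tail:
  assumes t: "bracket t a - scale \<alpha> a \<in> tail a (Suc 0)" and x: "x \<in> tail a k"
  shows "bracket t x \<in> tail a k"
  using x
proof (induction rule: tail_induct)
  case (power i)
  have "bracket t (left_power a i) - scale (of_nat (Suc i) * \<alpha>) (left_power a i) \<in> tail a k"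
    using left_mult_triangular[OF t, of i] tail_antimono[of k "Suc i" a] power by auto
  from tail_closed(1)[OF this tail_closed(3)[OF left_power_in_tail[OF power]],
      of "of_nat (Suc i) * \<alpha>"]
  show ?case
    by simp
next
  case closed
  then show ?case
    by (auto simp: subspace_def bracket_simps tail_closed)
qed

text \<open>Back substitution: the diagonal entries \<open>(i + 1) * \<alpha> - \<mu>\<close> with \<open>k \<le> i < n\<close> are nonzero, so
  the leading coefficient can be matched and the remainder lies one step deeper. With \<open>\<mu> = 1\<close>
  this corrects a generator to an eigenvector, with \<open>\<mu> = 0\<close> it corrects \<open>t\<close> to an element with square zero.\<close>

lemma left_mult_shifted_onto_tail:
  assumes t: "bracket t a - scale \<alpha> a \<in> tail a (Suc 0)" and top: "left_power a n = 0"
    and eigenvalue: "\<And>i. k \<le> i \<Longrightarrow> i < n \<Longrightarrow> of_nat (Suc i) * \<alpha> \<noteq> \<mu>"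
    and "k \<le> n" and "y \<in> tail a k"
  obtains x where "x \<in> tail a k" "bracket t x - scale \<mu> x = y"
proof -
  have "\<forall>y\<in>tail a k. \<exists>x\<in>tail a k. bracket t x - scale \<mu> x = y"
    using \<open>k \<le> n\<close> eigenvalue
  proof (induction rule: inc_induct)
    case base
    then show ?case
      by (simp add: tail_eq_zero[OF top] bracket_simps)
  next
    case (step k)
    show ?case
    proof
      fix y assume "y \<in> tail a k"
      then obtain c z where y: "y = scale c (left_power a k) + z" and z: "z \<in> tail a (Suc k)"
        by (rule tail_split)
      define d where "d = of_nat (Suc k) * \<alpha> - \<mu>"
      have "d \<noteq> 0"
        using step.prems[of k] step.hyps by (simp add: d_def)
      define u where "u = scale (c / d) (left_power a k)"
      define r where "r = bracket t (left_power a k) - scale (of_nat (Suc k) * \<alpha>) (left_power a k)"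
      have r: "r \<in> tail a (Suc k)"
        unfolding r_def by (rule left_mult_triangular[OF t])
      have u: "bracket t u - scale \<mu> u = scale c (left_power a k) + scale (c / d) r"
      proof -
        have "bracket t (left_power a k) - scale \<mu> (left_power a k) = scale d (left_power a k) + r"
          by (simp add: r_def d_def algebra_simps)
        then have "scale (c / d) (bracket t (left_power a k) - scale \<mu> (left_power a k))
            = scale (c / d) (scale d (left_power a k) + r)"
          by simp
        then show ?thesis
          using \<open>d \<noteq> 0\<close> by (simp add: u_def bracket_simps scale_right_distrib scale_right_diff_distrib mult.commute)
      qed
      \<comment> \<open>\<open>u\<close> leaves the off-diagonal error \<open>r\<close>, which lies deeper and is absorbed in the
        next equation.\<close>
      have "z - scale (c / d) r \<in> tail a (Suc k)"
        using z r by (simp add: tail_closed)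
      moreover have "\<forall>y\<in>tail a (Suc k). \<exists>x\<in>tail a (Suc k). bracket t x - scale \<mu> x = y"
        using step.prems by (intro step.IH) auto
      ultimately obtain v
        where v: "v \<in> tail a (Suc k)" "bracket t v - scale \<mu> v = z - scale (c / d) r"
        by blast
      have "u + v \<in> tail a k"
        using v(1) tail_antimono[of k "Suc k" a]
        by (auto simp: u_def tail_closed left_power_in_tail)
      moreover have "bracket t (u + v) - scale \<mu> (u + v) = y"
        using u v(2) by (simp add: y bracket_simps algebra_simps)
      ultimately show "\<exists>x\<in>tail a k. bracket t x - scale \<mu> x = y"
        by blast
    qed
  qed
  then show thesis
    using \<open>y \<in> tail a k\<close> that by blast
qed

text \<open>An eigenvector whose eigenvalue avoids the diagonal has zero leading coefficient, and so
  slips down the filtration to zero.\<close>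

lemma left_mult_eigenvector_zero:
  assumes t: "bracket t a - scale \<alpha> a \<in> tail a (Suc 0)"
    and top: "left_power a n = 0" "left_power a (n - 1) \<noteq> 0"
    and eigenvalue: "\<And>i. k \<le> i \<Longrightarrow> i < n \<Longrightarrow> of_nat (Suc i) * \<alpha> \<noteq> \<mu>"
    and "k \<le> n" and x: "x \<in> tail a k" "bracket t x = scale \<mu> x"
  shows "x = 0"
proof -
  have "x \<in> tail a n"
    using \<open>k \<le> n\<close>
  proof (induction rule: dec_induct)
    case base
    then show ?case using x by simp
  next
    case (step i)
    from step.IH obtain c y where xy: "x = scale c (left_power a i) + y"
      and y: "y \<in> tail a (Suc i)"
      by (rule tail_split)
    define r where "r = bracket t (left_power a i) - scale (of_nat (Suc i) * \<alpha>) (left_power a i)"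
    have r: "r \<in> tail a (Suc i)"
      unfolding r_def by (rule left_mult_triangular[OF t])
    define d where "d = of_nat (Suc i) * \<alpha> - \<mu>"
    have "d \<noteq> 0"
      using eigenvalue[of i] step.hyps by (simp add: d_def)
    have te: "bracket t (left_power a i) = scale (of_nat (Suc i) * \<alpha>) (left_power a i) + r"
      by (simp add: r_def)
    have "scale (c * d) (left_power a i) = scale \<mu> y - bracket t y - scale c r"
      using x(2) unfolding xy d_def bracket_add_right bracket_scale_right te
      by (simp add: algebra_simps)
    also have "\<dots> \<in> tail a (Suc i)"
      using y r left_mult_preserves_tail[OF t y] by (simp add: tail_closed)
    finally have mem: "scale (c * d) (left_power a i) \<in> tail a (Suc i)" .
    have "c = 0"
    proof (rule ccontr)
      assume "c \<noteq> 0"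
      then have "left_power a i \<in> tail a (Suc i)"
        using tail_closed(3)[OF mem, of "1 / (c * d)"] \<open>d \<noteq> 0\<close> by simp
      then show False
        using left_power_notin_tail[OF top step.hyps(2)] by simp
    qed
    then show ?case
      using xy y by simp
  qed
  then show ?thesis
    by (simp add: tail_eq_zero[OF top(1)])
qed

text \<open>With zero diagonal, left multiplications by \<open>t\<close> and by \<open>a\<close> both raise the filtration by one
  step. Together with elements annihilating from the left, \<open>t\<close> and \<open>a\<close> span the whole algebra.\<close>

lemma nilpotent_if_eigenvalue_zero:
  assumes t: "bracket t a \<in> tail a (Suc 0)" and top: "left_power a n = 0"
    and complement: "\<And>x. \<exists>c. x - scale c t \<in> tail a 0"
    and derived: "\<And>x y. bracket x y \<in> tail a 0"
  shows "nilpotent UNIV"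
proof -
  have shift: "bracket x y \<in> tail a (Suc k)" if y: "y \<in> tail a k" for x y k
  proof -
    obtain c where "x - scale c t \<in> tail a 0"
      using complement by blast
    then obtain d z where z: "x - scale c t = scale d a + z" "z \<in> tail a (Suc 0)"
      by (rule tail_split) (simp add: left_power_0)
    have "bracket x y = scale c (bracket t y) + bracket (x - scale c t) y"
      by (simp add: bracket_simps)
    also have "\<dots> = scale c (bracket t y) + scale d (bracket a y)"
      by (simp only: bracket_left_mod_tail[OF z])
    finally have xy: "bracket x y = scale c (bracket t y) + scale d (bracket a y)" .
    have t0: "bracket t a - scale 0 a \<in> tail a (Suc 0)"
      using t by simp
    from y obtain e w where w: "y = scale e (left_power a k) + w" "w \<in> tail a (Suc k)"
      by (rule tail_split)
    have "bracket t (left_power a k) \<in> tail a (Suc k)"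
      using left_mult_triangular[OF t0, of k] by simp
    then have "bracket t y \<in> tail a (Suc k)"
      using left_mult_preserves_tail[OF t0 w(2)] by (simp add: w(1) bracket_simps tail_closed)
    then show ?thesis
      unfolding xy using bracket_generator_tail[OF y] by (simp add: tail_closed)
  qed
  have "lower_central UNIV (Suc k) \<subseteq> tail a k" for k
  proof (induction k)
    case 0
    show ?case
      unfolding lower_central.simps using derived by (intro span_minimal subspace_tail) blast
  next
    case (Suc k)
    then show ?case
      unfolding lower_central.simps(2)[of UNIV "Suc k"]
      using shift by (intro span_minimal subspace_tail) blast
  qed
  from this[of n] have "lower_central UNIV (Suc n) = {0}"
    using span_zero by (auto simp: tail_eq_zero[OF top])
  then show ?thesis
    unfolding nilpotent_def by blast
qed

section \<open>Changing the generator\<close>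

text \<open>Left multiplications by \<open>a - x\<close> and \<open>a\<close> coincide, so the powers of both generators arise
  from different starting vectors under the same map.\<close>

lemma left_power_perturbed:
  assumes x: "x \<in> tail a (Suc 0)"
  shows "left_power (a - x) k - left_power a k \<in> tail a (Suc k)"
proof (induction k)
  case 0
  show ?case
    using tail_closed(3)[OF x, of "-1"] by (simp add: left_power_0)
next
  case (Suc k)
  have "left_power (a - x) (Suc k) - left_power a (Suc k)
      = bracket a (left_power (a - x) k - left_power a k)"
    by (simp add: left_power_Suc bracket_simps tail_one_left_annihilates[OF x])
  then show ?case
    using bracket_generator_tail[OF Suc] by simp
qed

lemma change_generator:
  assumes x: "x \<in> tail a (Suc 0)"
    and top: "left_power a n = 0" "left_power a (n - 1) \<noteq> 0"
  shows "tail (a - x) 0 = tail a 0" "left_power (a - x) n = 0" "left_power (a - x) (n - 1) \<noteq> 0"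
proof -
  have "n \<noteq> 0"
    using top by (intro notI) simp
  have zero: "tail a (Suc n) = {0}" "tail a n = {0}"
    using top by (simp_all add: tail_eq_zero left_power_Suc bracket_simps)
  show "left_power (a - x) n = 0" "left_power (a - x) (n - 1) \<noteq> 0"
    using left_power_perturbed[OF x, of n] left_power_perturbed[OF x, of "n - 1"]
      zero top \<open>n \<noteq> 0\<close> by simp_all
  have "tail a k \<subseteq> tail (a - x) k" if "k \<le> n" for k
    using that
  proof (induction rule: inc_induct)
    case base
    show ?case by (simp add: zero tail_closed)
  next
    case (step k)
    show ?case
    proof
      fix y assume "y \<in> tail a k"
      then obtain c z where y: "y = scale c (left_power a k) + z" and z: "z \<in> tail a (Suc k)"
        by (rule tail_split)
      define r where "r = left_power (a - x) k - left_power a k"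
      have "r \<in> tail a (Suc k)"
        unfolding r_def by (rule left_power_perturbed[OF x])
      with z have "r \<in> tail (a - x) k" "z \<in> tail (a - x) k"
        using step.IH tail_antimono[of k "Suc k" "a - x"] by auto
      moreover have "left_power a k = left_power (a - x) k - r"
        by (simp add: r_def)
      ultimately show "y \<in> tail (a - x) k"
        using left_power_in_tail[of k k "a - x"] by (simp add: y tail_closed)
    qed
  qed
  moreover have "tail (a - x) 0 \<subseteq> tail a 0"
  proof -
    have "left_power (a - x) k \<in> tail a 0" for k
      using tail_closed(1)[of "left_power (a - x) k - left_power a k" a 0 "left_power a k"]
        left_power_perturbed[OF x, of k] tail_antimono[of 0 "Suc k" a] left_power_in_tail[of 0 k a]
      by auto
    then show ?thesis
      unfolding tail_def[of "a - x"] by (intro span_minimal subspace_tail) auto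
  qed
  ultimately show "tail (a - x) 0 = tail a 0"
    by blast
qed

lemma left_mult_eigen_powers:
  assumes "bracket s a = a"
  shows "bracket s (left_power a k) = scale (of_nat (Suc k)) (left_power a k)"
proof (induction k)
  case 0
  show ?case
    using assms by (simp add: left_power_0)
next
  case (Suc k)
  have "bracket s (left_power a (Suc k))
      = left_power a (Suc k) + bracket a (bracket s (left_power a k))"
    using left_mult_derivation[of s a "left_power a k"] by (simp add: left_power_Suc assms)
  moreover have "scale (of_nat (Suc (Suc k))) y = y + scale (of_nat (Suc k)) y" for y
    by (simp only: of_nat_Suc[of "Suc k"] scale_left_distrib scale_one)
  ultimately show ?case
    by (simp only: Suc bracket_scale_right left_power_Suc)
qed

section \<open>Ideals of codimension one\<close>

lemma codim_one_complement:
  assumes "finite_dimensional" "subspace K" "dim K + 1 = dim UNIV"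
  obtains t where "t \<notin> K" "\<And>x. \<exists>c. x - scale c t \<in> K"
proof -
  obtain S where S: "finite S" "span S = UNIV"
    using assms(1) by (auto simp: finite_dimensional_def)
  obtain B where B: "B \<subseteq> UNIV" "independent B" "UNIV \<subseteq> span B" "card B = dim UNIV"
    by (rule basis_exists)
  have "finite B"
    using independent_span_bound[OF S(1) B(2)] S(2) by simp
  interpret finite_dimensional_vector_space scale B
    using B \<open>finite B\<close> by unfold_locales auto
  have "K \<noteq> UNIV"
    using assms(3) by auto
  then obtain t where t: "t \<notin> K"
    by auto
  have span_K: "span K = K"
    using assms(2) by (simp add: span_eq_iff)
  have "dim (insert t K) = dim UNIV"
    using assms(3) t by (simp add: dim_insert span_K)
  then have "span (insert t K) = UNIV"
    by (simp only: dim_UNIV flip: dim_eq_full dimension_def)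
  then have "\<exists>c. x - scale c t \<in> K" for x
    using span_breakdown_eq[of x t K] by (simp add: span_K)
  with t show thesis
    by (rule that)
qed

text \<open>The quotient is a one-dimensional Leibniz algebra. If \<open>[t, t]\<close> were \<open>c t\<close> in it, then
  \<open>[[t, t], t] = 0\<close> would read \<open>c\<^sup>2 t = 0\<close>, so the quotient has zero product.\<close>

lemma codim_one_ideal_absorbs_products:
  assumes K: "ideal K" and t: "t \<notin> K" and complement: "\<And>x. \<exists>c. x - scale c t \<in> K"
  shows "bracket x y \<in> K"
proof -
  have sub: "subspace K"
    using K by (simp add: ideal_def)
  note closed = subspace_add[OF sub] subspace_diff[OF sub] subspace_scale[OF sub]
  have K_left: "bracket k z \<in> K" and K_right: "bracket z k \<in> K" if "k \<in> K" for k z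
    using K that by (auto simp: ideal_def)
  obtain c where "bracket t t - scale c t \<in> K"
    using complement by blast
  define k where "k = bracket t t - scale c t"
  have k: "k \<in> K"
    unfolding k_def by fact
  have tt: "bracket t t = scale c t + k"
    by (simp add: k_def)
  have "bracket k t = - scale c (scale c t + k)"
    unfolding tt[symmetric] by (simp add: k_def bracket_simps square_left_annihilates)
  then have "scale (c * c) t = scale (-1) (bracket k t + scale c k)"
    by (simp add: scale_right_distrib)
  also have "\<dots> \<in> K"
    by (intro closed K_left k)
  finally have mem: "scale (c * c) t \<in> K" .
  have "c = 0"
    using closed(3)[OF mem, of "1 / (c * c)"] t by (cases "c = 0") simp_all
  then have tt: "bracket t t \<in> K"
    using tt k by simp
  obtain c d where "x - scale c t \<in> K" "y - scale d t \<in> K"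
    using complement by blast
  moreover have "bracket x y = bracket (x - scale c t) y
      + scale c (bracket t (y - scale d t)) + scale (c * d) (bracket t t)"
    by (simp add: bracket_simps scale_right_diff_distrib)
  ultimately show ?thesis
    using tt by (simp add: closed K_left K_right)
qed

end

section \<open>The structure theorem\<close>

theorem theorem3:
  fixes scale :: "'f::field_char_0 \<Rightarrow> 'v::ab_group_add \<Rightarrow> 'v"
    and br :: "'v \<Rightarrow> 'v \<Rightarrow> 'v"
    and n :: nat
    and K :: "'v set"
  assumes leibniz: "leibniz_algebra scale br"
    and fin_dim: "leibniz_algebra.finite_dimensional scale"
    and dim: "vector_space.dim scale (UNIV :: 'v set) = n + 1" "n + 1 \<ge> 3"
    and non_nilpotent: "\<not> leibniz_algebra.nilpotent scale br UNIV"
    and ideal: "leibniz_algebra.ideal scale br K"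
    and codim: "vector_space.dim scale K + 1 = vector_space.dim scale (UNIV :: 'v set)"
    and cyclic: "leibniz_algebra.cyclic scale br K"
    and nilpotent: "leibniz_algebra.nilpotent scale br K"
  shows "\<exists>s b. leibniz_algebra.basis_family scale K {1..n} b
    \<and> (leibniz_algebra.direct_sum scale UNIV K (leibniz_algebra.generated scale br {s})
        \<and> s \<noteq> 0 \<and> br s s = 0
        \<and> leibniz_algebra.generated scale br {s} = range (\<lambda>c. scale c s))
    \<and> (br (b 1) (b 1) = b 2
        \<and> (\<forall>j\<in>{3..n}. br (b 1) (b (j - 1)) = b j)
        \<and> br (b 1) (b n) = 0
        \<and> (\<forall>m\<in>{2..n}. \<forall>k\<in>{1..n}. br (b m) (b k) = 0))
    \<and> (br (b 1) s = - b 1 \<and> (\<forall>j\<in>{2..n}. br (b j) s = 0))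
    \<and> (\<forall>j\<in>{1..n}. br s (b j) = scale (of_nat j) (b j))"
proof -
  interpret leibniz_algebra scale br
    by (fact leibniz)

  have sub: "subspace K"
    using ideal by (simp add: ideal_def)
  have dim_K: "dim K = n" and n: "2 \<le> n"
    using codim dim by simp_all
  obtain a where K: "K = tail a 0"
    and top: "left_power a n = 0" "left_power a (n - 1) \<noteq> 0"
    using cyclic_nilpotent_generator[OF cyclic nilpotent] dim_K n by auto
  obtain t0 where t0: "t0 \<notin> K" and complement: "\<And>x. \<exists>c. x - scale c t0 \<in> K"
    using codim_one_complement[OF fin_dim sub codim] by blast
  have derived: "br x y \<in> K" for x y
    by (rule codim_one_ideal_absorbs_products[OF ideal t0 complement])

  obtain \<alpha> u where \<alpha>: "br t0 a = scale \<alpha> a + u" and u: "u \<in> tail a (Suc 0)"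
    using derived[of t0 a] unfolding K by (rule tail_split) (simp add: left_power_0)
  have "\<alpha> \<noteq> 0"
  proof
    assume "\<alpha> = 0"
    then have "br t0 a \<in> tail a (Suc 0)"
      using \<alpha> u by simp
    then have "nilpotent UNIV"
      using complement derived by (intro nilpotent_if_eigenvalue_zero[OF _ top(1)]) (simp_all add: K)
    with non_nilpotent show False
      by contradiction
  qed
  define t where "t = scale (1 / \<alpha>) t0"
  have t0_eq: "t0 = scale \<alpha> t"
    using \<open>\<alpha> \<noteq> 0\<close> by (simp add: t_def)
  have "br t a - a = scale (1 / \<alpha>) u"
    using \<open>\<alpha> \<noteq> 0\<close> by (simp add: t_def bracket_simps \<alpha> scale_right_distrib)
  then have ta: "br t a - scale 1 a \<in> tail a (Suc 0)"
    using u by (simp add: tail_closed)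

  have square: "br g g \<noteq> 0" if "left_power g n = 0" "left_power g (n - 1) \<noteq> 0" for g
  proof
    assume "br g g = 0"
    then have "tail g (Suc 0) = {0}"
      by (intro tail_eq_zero) (simp add: left_power_Suc left_power_0)
    then show False
      using left_power_in_tail[of "Suc 0" "n - 1" g] that(2) n by auto
  qed
  \<comment> \<open>Annihilating the generator from the left detects a zero leading coefficient, because the
    square of the generator is nonzero; this uses that the dimension is at least two.\<close>
  have in_tail_one: "y \<in> tail g (Suc 0)"
    if g: "left_power g n = 0" "left_power g (n - 1) \<noteq> 0" and y: "y \<in> tail g 0" "br y g = 0"
    for g y
  proof -
    obtain c z where cz: "y = scale c g + z" "z \<in> tail g (Suc 0)"
      using y(1) by (rule tail_split) (simp add: left_power_0)
    then have "scale c (br g g) = 0"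
      using y(2) bracket_left_mod_tail[OF cz, of g] by simp
    then show ?thesis
      using square[OF g] cz by simp
  qed

  \<comment> \<open>The correction \<open>x\<close> is chosen to make \<open>a - x\<close> an eigenvector; it exists since the
    eigenvalues \<open>2, \<dots>, n\<close> on the first tail differ from \<open>1\<close>.\<close>
  obtain x where x: "x \<in> tail a (Suc 0)" "br t x - scale 1 x = br t a - scale 1 a"
    by (rule left_mult_shifted_onto_tail[OF ta top(1) _ _ ta, where \<mu> = 1])
      (use n in auto)
  have "br t t \<in> tail a (Suc 0)"
    using derived[of t t] by (intro in_tail_one top) (simp_all add: K square_left_annihilates)
  then obtain w where w: "w \<in> tail a (Suc 0)" "br t w - scale 0 w = br t t"
    by (rule left_mult_shifted_onto_tail[OF ta top(1), where k = "Suc 0" and \<mu> = 0 and y = "br t t", rotated 2])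
      (use n in \<open>auto simp del: of_nat_Suc\<close>)

  define b1 where "b1 = a - x"
  define s where "s = t - w"
  note b1_top = change_generator(2,3)[OF x(1) top, folded b1_def]
  have K_b1: "K = tail b1 0"
    unfolding K b1_def by (rule change_generator(1)[OF x(1) top, symmetric])
  have s_left: "br s y = br t y" for y
    by (simp add: s_def bracket_simps tail_one_left_annihilates[OF w(1)])
  have ss: "br s s = 0"
    unfolding s_left using w(2) by (simp add: s_def bracket_simps)
  have sb1: "br s b1 = b1"
    unfolding s_left using x(2) by (simp add: b1_def bracket_simps algebra_simps)

  have "w \<in> K"
    using w(1) tail_antimono[of 0 "Suc 0" a] by (auto simp: K)
  have t_eq: "t = s + w"
    by (simp add: s_def)
  have s_notin: "s \<notin> K"
    using t0 \<open>w \<in> K\<close> by (auto simp: t0_eq t_eq K tail_closed)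
  have "s \<noteq> 0"
    using s_notin subspace_0[OF sub] by auto
  note gen_s = generated_square_zero[OF ss]

  have "direct_sum UNIV K (generated {s})"
    unfolding direct_sum_def
  proof (intro conjI)
    show "subspace K" by (fact sub)
    show "subspace (generated {s})"
      by (simp add: generated_eq_tail subspace_tail)
    have "\<exists>u v. x = u + v \<and> u \<in> K \<and> v \<in> generated {s}" for x
    proof -
      obtain c where "x - scale c t0 \<in> K"
        using complement by blast
      then have "x - scale c t0 + scale (c * \<alpha>) w \<in> K"
        using \<open>w \<in> K\<close> by (simp add: K tail_closed)
      moreover have "x = (x - scale c t0 + scale (c * \<alpha>) w) + scale (c * \<alpha>) s"
        by (simp add: t0_eq t_eq scale_right_distrib)
      ultimately show ?thesis
        unfolding gen_s by blast
    qed
    then show "UNIV = {u + v | u v. u \<in> K \<and> v \<in> generated {s}}"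
      by blast
    have "c = 0" if "scale c s \<in> K" for c
      using subspace_scale[OF sub that, of "1 / c"] s_notin by (cases "c = 0") simp_all
    then show "K \<inter> generated {s} = {0}"
      unfolding gen_s using subspace_0[OF sub] by (auto intro: range_eqI[of _ _ 0])
  qed

  \<comment> \<open>The Leibniz rule with \<open>[s, s] = 0\<close> makes \<open>[b1, s]\<close>, and hence \<open>y\<close>, an eigenvector of
    eigenvalue \<open>1\<close>; symmetrization puts \<open>y\<close> where \<open>1\<close> is not an eigenvalue.\<close>
  have b1s: "br b1 s = - b1"
  proof -
    define y where "y = br b1 s + b1"
    have "y \<in> tail b1 0"
      using derived[of b1 s] left_power_in_tail[of 0 0 b1]
      by (simp add: y_def K_b1 left_power_0 tail_closed)
    moreover have "br y b1 = 0"
      using symmetrized_left_annihilates[of b1 s b1] by (simp add: y_def sb1)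
    ultimately have "y \<in> tail b1 (Suc 0)"
      by (intro in_tail_one b1_top)
    moreover have "br s y = scale 1 y"
      using left_mult_derivation[of s b1 s] by (simp add: y_def bracket_simps sb1 ss)
    ultimately have "y = 0"
      using n sb1
      by (intro left_mult_eigenvector_zero[OF _ b1_top, of s 1 "Suc 0" 1 y]) (auto simp: tail_closed)
    then show ?thesis
      by (simp add: y_def eq_neg_iff_add_eq_0)
  qed

  define b where "b j = left_power b1 (j - 1)" for j
  have b_Suc: "b (Suc j) = left_power b1 j" for j
    by (simp add: b_def)
  have b_1: "b 1 = b1"
    by (simp add: b_def left_power_0)
  have b_step: "br b1 (b (j - 1)) = b j" if "2 \<le> j" for j
    using that by (auto simp: b_def left_power_Suc[symmetric] intro!: arg_cong[where f = "left_power b1"])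
  have b_left: "br (b m) y = 0" if "2 \<le> m" for m y
    using that by (intro tail_one_left_annihilates[of _ b1]) (auto simp: b_def intro: left_power_in_tail)
  have "basis_family K {1..n} b"
  proof -
    have "{1..n} = Suc ` {..<n}"
      by (simp add: lessThan_atLeast0 image_Suc_atLeastLessThan atLeastLessThanSuc_atLeastAtMost)
    then show ?thesis
      using left_powers_independent[OF b1_top] span_left_powers[OF b1_top(1)]
      by (simp add: basis_family_def K_b1 image_image b_Suc inj_on_def)
  qed
  moreover have "br s (b j) = scale (of_nat j) (b j)" if "j \<in> {1..n}" for j
    using left_mult_eigen_powers[OF sb1, of "j - 1"] that by (simp add: b_def)
  moreover have "br b1 (b n) = 0"
    using b1_top(1) b_step[of "Suc n"] n by (simp add: b_def)
  ultimately show ?thesis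
    using \<open>direct_sum UNIV K (generated {s})\<close> \<open>s \<noteq> 0\<close> ss gen_s b_step[of 2] b_step b_left b1s
    by (intro exI[of _ s] exI[of _ b]) (simp add: b_1[simplified])
qed

end
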